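(* Let $D$ be a finitely generated abelian group and $(S,B)$ a conical ring such that $S$ is a factorially and effectively $D$-graded integral domain. (a) For any set $E\subseteq B$ of homogeneous elements such that the ideal $(E)$ is radical, one has $I_B(V_B(E))=\mathrm{rad}_B(\mathfrak a)$, where $\mathfrak a$ is the restriction to $B$ of the graded ideal of $S$ generated by $E$, and $\mathrm{rad}_B(\mathfrak a)=\mathrm{rad}(\mathfrak a)\cap B$. (b) For any subset $Y\subseteq\mathrm{Proj}^D_B(S)$, the closure of $Y$ is $\overline Y=V_+(I_B(Y))$.
   Context: Rings are commutative and unital. $S=\bigoplus_{d\in D}S_d$ is effectively graded if $D$ is generated by $\{d\mid S_d\ne0\}$. A nonzero nonunit homogeneous $f$ is a $D$-prime element if for all homogeneous $g,h$ with $f\mid gh$ one has $f\mid g$ or $f\mid h$. A (proper) graded ideal $\mathfrak p$ is $D$-prime if for homogeneous $f,g$ with $fg\in\mathfrak p$ one has $f\in\mathfrak p$ or $g\in\mathfrak p$. A $D$-graded integral domain is factorially $D$-graded if every nonzero nonunit homogeneous element is a product of $D$-prime elements. For homogeneous $f$, $D^f=\{\deg(u)\mid u\text{ a homogeneous unit of }S_f\}$; $f$ is relevant if it is homogeneous and $D^f$ has finite index in $D$. $S_+$ is the ideal generated by the relevant elements. A conical ring $(S,B)$ is a multigraded ring $S$ with an ideal $B\unlhd S$, $B\subseteq S_+$. $\mathrm{Proj}^D_B(S)$, the gluing of the affine schemes $\mathrm{Spec}(S_{(f)})$ ($S_{(f)}$ the degree-zero part of $S_f$) for $f\in B$ relevant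 along the $\mathrm{Spec}(S_{(fg)})$, is identified as a topological space with the space of $D$-prime ideals $\mathfrak p$ of $S$ with $B\not\subset\mathfrak p$, via $\{\mathfrak p \mid f\notin\mathfrak p\}\to\mathrm{Spec}(S_{(f)})$, $\mathfrak p\mapsto\mathfrak pS_f\cap S_{(f)}$, for relevant $f\in B$. Its closed sets are the sets $V_+(E)=V_B(E)=\{\mathfrak p\in\mathrm{Proj}^D_B(S)\mid E\subseteq\mathfrak p\}$ for $E\subseteq S$ homogeneous (and radical, if $D$ has torsion). For $Y\subseteq\mathrm{Proj}^D_B(S)$, the $B$-vanishing ideal is $I_B(Y)=\{f\in B\mid Y\subseteq V_+(f)\}=I(Y)\cap B$, where $I(Y)=\bigcap_{y\in Y}\mathfrak p_y$ and $\mathfrak p_y$ is the $D$-prime ideal corresponding to $y$. *)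

theory Defs
  imports
    "HOL-Analysis.Abstract_Topology"
    "HOL-Computational_Algebra.Fraction_Field"
    "HOL-Computational_Algebra.Group_Closure"
begin

section \<open>Ideals\<close>

abbreviation is_ideal :: "'a::comm_ring_1 set \<Rightarrow> bool"
  where "is_ideal \<equiv> module.subspace (*)"

abbreviation ideal_gen :: "'a::comm_ring_1 set \<Rightarrow> 'a set"
  where "ideal_gen \<equiv> module.span (*)"

definition rad :: "'a::comm_ring_1 set \<Rightarrow> 'a set"
  where "rad I = {x. \<exists>n::nat. x ^ n \<in> I}"

definition rad_in :: "'a::comm_ring_1 set \<Rightarrow> 'a set \<Rightarrow> 'a set"
  where "rad_in B I = rad I \<inter> B"

text \<open>The prime ideals of a subring \<open>A\<close> of the ambient ring.\<close>

definition prime_ideal_of :: "'a::comm_ring_1 set \<Rightarrow> 'a set \<Rightarrow> bool"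
  where "prime_ideal_of A q \<longleftrightarrow>
    q \<subseteq> A \<and> 0 \<in> q \<and> (\<forall>x\<in>q. \<forall>y\<in>q. x + y \<in> q) \<and> (\<forall>a\<in>A. \<forall>x\<in>q. a * x \<in> q) \<and>
    1 \<notin> q \<and> (\<forall>a\<in>A. \<forall>b\<in>A. a * b \<in> q \<longrightarrow> a \<in> q \<or> b \<in> q)"

definition Spec :: "'a::comm_ring_1 set \<Rightarrow> 'a set topology"
  where "Spec A = topology (\<lambda>U. \<exists>J\<subseteq>A. U = {q. prime_ideal_of A q \<and> \<not> J \<subseteq> q})"


section \<open>Graded rings\<close>

definition homogeneous_decomposition ::
    "('d \<Rightarrow> 'a::comm_ring_1 set) \<Rightarrow> 'a \<Rightarrow> ('d \<Rightarrow> 'a) \<Rightarrow> bool"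
  where "homogeneous_decomposition G x c \<longleftrightarrow>
    (\<forall>d. c d \<in> G d) \<and> finite {d. c d \<noteq> 0} \<and> x = (\<Sum>d | c d \<noteq> 0. c d)"

text \<open>The family \<open>G\<close> is a grading of the whole type \<open>'a\<close> by the group \<open>'d\<close>; \<open>G d\<close> is
  the piece of degree \<open>d\<close>.\<close>

locale graded_ring =
  fixes G :: "'d::ab_group_add \<Rightarrow> 'a::comm_ring_1 set"
  assumes zero_in_piece: "0 \<in> G d"
    and add_in_piece: "x \<in> G d \<Longrightarrow> y \<in> G d \<Longrightarrow> x + y \<in> G d"
    and uminus_in_piece: "x \<in> G d \<Longrightarrow> - x \<in> G d"
    and one_in_piece: "1 \<in> G 0"
    and mult_in_piece: "x \<in> G d \<Longrightarrow> y \<in> G e \<Longrightarrow> x * y \<in> G (d + e)"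
    and direct_sum: "\<exists>!c. homogeneous_decomposition G x c"

definition effectively_graded :: "('d::ab_group_add \<Rightarrow> 'a::comm_ring_1 set) \<Rightarrow> bool"
  where "effectively_graded G \<longleftrightarrow> group_closure {d. G d \<noteq> {0}} = UNIV"

definition homogeneous :: "('d \<Rightarrow> 'a set) \<Rightarrow> 'a \<Rightarrow> bool"
  where "homogeneous G x \<longleftrightarrow> (\<exists>d. x \<in> G d)"

definition graded_ideal :: "('d \<Rightarrow> 'a::comm_ring_1 set) \<Rightarrow> 'a set \<Rightarrow> bool"
  where "graded_ideal G I \<longleftrightarrow> is_ideal I \<and>
    (\<forall>x\<in>I. \<forall>c. homogeneous_decomposition G x c \<longrightarrow> (\<forall>d. c d \<in> I))"

definition D_prime_ideal :: "('d \<Rightarrow> 'a::comm_ring_1 set) \<Rightarrow> 'a set \<Rightarrow> bool"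
  where "D_prime_ideal G p \<longleftrightarrow> graded_ideal G p \<and> p \<noteq> UNIV \<and>
    (\<forall>f g. homogeneous G f \<longrightarrow> homogeneous G g \<longrightarrow> f * g \<in> p \<longrightarrow> f \<in> p \<or> g \<in> p)"

definition D_prime_element :: "('d \<Rightarrow> 'a::comm_ring_1 set) \<Rightarrow> 'a \<Rightarrow> bool"
  where "D_prime_element G f \<longleftrightarrow> homogeneous G f \<and> f \<noteq> 0 \<and> \<not> f dvd 1 \<and>
    (\<forall>g h. homogeneous G g \<longrightarrow> homogeneous G h \<longrightarrow> f dvd g * h \<longrightarrow> f dvd g \<or> f dvd h)"

definition factorially_graded :: "('d \<Rightarrow> 'a::comm_ring_1 set) \<Rightarrow> bool"
  where "factorially_graded G \<longleftrightarrow>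
    (\<forall>x. homogeneous G x \<longrightarrow> x \<noteq> 0 \<longrightarrow> \<not> x dvd 1 \<longrightarrow>
      (\<exists>fs. (\<forall>f\<in>set fs. D_prime_element G f) \<and> x = prod_list fs))"


section \<open>Relevant elements and conical rings\<close>

text \<open>For a homogeneous \<open>f \<noteq> 0\<close> of an integral domain, the localization \<open>S\<^sub>f\<close> is realized
  inside the fraction field; \<open>loc_piece G f e\<close> is its piece of degree \<open>e\<close>, so that
  \<open>S\<^bsub>(f)\<^esub>\<close> is \<open>loc_piece G f 0\<close>.\<close>

definition loc :: "'a::idom \<Rightarrow> 'a fract set"
  where "loc f = {Fract a (f ^ n) |a n. True}"

definition loc_piece :: "('d::ab_group_add \<Rightarrow> 'a::idom set) \<Rightarrow> 'a \<Rightarrow> 'd \<Rightarrow> 'a fract set"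
  where "loc_piece G f e = {Fract a (f ^ n) |a n d d'. a \<in> G d \<and> f ^ n \<in> G d' \<and> e = d - d'}"

definition unit_degrees :: "('d::ab_group_add \<Rightarrow> 'a::idom set) \<Rightarrow> 'a \<Rightarrow> 'd set"
  where "unit_degrees G f = {e. \<exists>u\<in>loc_piece G f e. \<exists>v\<in>loc f. u * v = 1}"

text \<open>Finite index is expressed by finiteness of the set of cosets. The element \<open>0\<close> is left
  out since \<open>loc 0\<close> is not the localization; this affects neither the ideal generated by the
  relevant elements nor the charts of Proj below, as \<open>0\<close> lies in every ideal.\<close>

definition relevant :: "('d::ab_group_add \<Rightarrow> 'a::idom set) \<Rightarrow> 'a \<Rightarrow> bool"
  where "relevant G f \<longleftrightarrow> homogeneous G f \<and> f \<noteq> 0 \<and>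
    finite (range (\<lambda>d. (\<lambda>e. d + e) ` unit_degrees G f))"

definition S_plus :: "('d::ab_group_add \<Rightarrow> 'a::idom set) \<Rightarrow> 'a set"
  where "S_plus G = ideal_gen {f. relevant G f}"

locale conical_ring = graded_ring G for G :: "'d::ab_group_add \<Rightarrow> 'a::idom set" +
  fixes B :: "'a set"
  assumes ideal_B: "is_ideal B"
    and B_subset: "B \<subseteq> S_plus G"


section \<open>Multigraded Proj\<close>

definition Proj :: "('d \<Rightarrow> 'a::comm_ring_1 set) \<Rightarrow> 'a set \<Rightarrow> 'a set set"
  where "Proj G B = {p. D_prime_ideal G p \<and> \<not> B \<subseteq> p}"

text \<open>The chart \<open>p \<mapsto> p S\<^sub>f \<inter> S\<^bsub>(f)\<^esub>\<close> on the set of all \<open>p\<close> with \<open>f \<notin> p\<close>.\<close>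

definition chart :: "('d::ab_group_add \<Rightarrow> 'a::idom set) \<Rightarrow> 'a \<Rightarrow> 'a set \<Rightarrow> 'a fract set"
  where "chart G f p = {Fract a (f ^ n) |a n. a \<in> p} \<inter> loc_piece G f 0"

definition chart_open :: "('d::ab_group_add \<Rightarrow> 'a::idom set) \<Rightarrow> 'a set \<Rightarrow> 'a \<Rightarrow> 'a set set \<Rightarrow> bool"
  where "chart_open G B f U \<longleftrightarrow>
    openin (pullback_topology {p \<in> Proj G B. f \<notin> p} (chart G f) (Spec (loc_piece G f 0)))
      {p \<in> U. f \<notin> p}"

text \<open>The topology glued from the charts. All relevant \<open>f\<close> are used, not only those in
  \<open>B\<close>: if \<open>B\<close> is graded this makes no difference (\<open>openin_Proj_graded\<close> below), but if \<open>B\<close>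
  is not graded, then the relevant elements of \<open>B\<close> need not cover \<open>Proj G B\<close>. In either
  case the closed sets are the sets \<open>V_plus G B E\<close> with \<open>E\<close> homogeneous
  (\<open>closedin_Proj_iff\<close> below).\<close>

definition Proj_topology :: "('d::ab_group_add \<Rightarrow> 'a::idom set) \<Rightarrow> 'a set \<Rightarrow> 'a set topology"
  where "Proj_topology G B =
    topology (\<lambda>U. U \<subseteq> Proj G B \<and> (\<forall>f. relevant G f \<longrightarrow> chart_open G B f U))"

definition V_plus :: "('d \<Rightarrow> 'a::comm_ring_1 set) \<Rightarrow> 'a set \<Rightarrow> 'a set \<Rightarrow> 'a set set"
  where "V_plus G B E = {p \<in> Proj G B. E \<subseteq> p}"

definition vanishing_ideal ::
    "('d \<Rightarrow> 'a::comm_ring_1 set) \<Rightarrow> 'a set \<Rightarrow> 'a set set \<Rightarrow> 'a set"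
  where "vanishing_ideal G B Y = {f \<in> B. Y \<subseteq> V_plus G B {f}}"


section \<open>The topologies\<close>

interpretation idl: module "(*) :: 'a::comm_ring_1 \<Rightarrow> 'a \<Rightarrow> 'a"
  by standard (simp_all add: algebra_simps)

definition mult_closed :: "'a::comm_ring_1 set \<Rightarrow> bool" where
  "mult_closed A \<longleftrightarrow> 1 \<in> A \<and> (\<forall>a\<in>A. \<forall>b\<in>A. a * b \<in> A)"

lemma istop_Spec:
  fixes A :: "'a::comm_ring_1 set"
  assumes A: "mult_closed A"
  shows "istopology (\<lambda>U. \<exists>J\<subseteq>A. U = {q. prime_ideal_of A q \<and> \<not> J \<subseteq> q})"
  unfolding istopology_def
proof (intro conjI allI impI)
  fix S T assume "\<exists>J\<subseteq>A. S = {q. prime_ideal_of A q \<and> \<not> J \<subseteq> q}"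
    and "\<exists>J\<subseteq>A. T = {q. prime_ideal_of A q \<and> \<not> J \<subseteq> q}"
  then obtain J K where J: "J \<subseteq> A" "S = {q. prime_ideal_of A q \<and> \<not> J \<subseteq> q}"
    and K: "K \<subseteq> A" "T = {q. prime_ideal_of A q \<and> \<not> K \<subseteq> q}" by auto
  let ?L = "{a * b |a b. a \<in> J \<and> b \<in> K}"
  have "?L \<subseteq> A" using A J K by (auto simp: mult_closed_def)
  moreover have "\<not> J \<subseteq> q \<and> \<not> K \<subseteq> q \<longleftrightarrow> \<not> ?L \<subseteq> q" if "prime_ideal_of A q" for q
  proof
    assume "\<not> J \<subseteq> q \<and> \<not> K \<subseteq> q"
    then obtain a b where ab: "a \<in> J" "a \<notin> q" "b \<in> K" "b \<notin> q" by auto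
    with J K that have "a * b \<notin> q" unfolding prime_ideal_of_def by blast
    with ab show "\<not> ?L \<subseteq> q" by blast
  next
    assume "\<not> ?L \<subseteq> q"
    then obtain a b where ab: "a \<in> J" "b \<in> K" "a * b \<notin> q" by auto
    with that J K have "a \<notin> q" "b \<notin> q" unfolding prime_ideal_of_def
      by (metis mult.commute subsetD)+
    with ab show "\<not> J \<subseteq> q \<and> \<not> K \<subseteq> q" by blast
  qed
  ultimately have "S \<inter> T = {q. prime_ideal_of A q \<and> \<not> ?L \<subseteq> q}"
    unfolding J(2) K(2) by fast
  with \<open>?L \<subseteq> A\<close> show "\<exists>L\<subseteq>A. S \<inter> T = {q. prime_ideal_of A q \<and> \<not> L \<subseteq> q}"
    by (intro exI[of _ ?L] conjI)
next
  fix K assume "\<forall>U\<in>K. \<exists>J\<subseteq>A. U = {q. prime_ideal_of A q \<and> \<not> J \<subseteq> q}"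
  then obtain j where j: "\<forall>U\<in>K. j U \<subseteq> A \<and> U = {q. prime_ideal_of A q \<and> \<not> j U \<subseteq> q}"
    by metis
  have "\<Union>K = (\<Union>U\<in>K. {q. prime_ideal_of A q \<and> \<not> j U \<subseteq> q})"
    using j by (simp cong: SUP_cong_simp)
  also have "\<dots> = {q. prime_ideal_of A q \<and> \<not> \<Union>(j ` K) \<subseteq> q}" by auto
  finally show "\<exists>J\<subseteq>A. \<Union>K = {q. prime_ideal_of A q \<and> \<not> J \<subseteq> q}"
    using j by (intro exI[of _ "\<Union>(j ` K)"] conjI) auto
qed

lemma openin_Spec:
  "mult_closed A \<Longrightarrow> openin (Spec A) U \<longleftrightarrow> (\<exists>J\<subseteq>A. U = {q. prime_ideal_of A q \<and> \<not> J \<subseteq> q})"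
  by (simp add: Spec_def istop_Spec topology_inverse')

lemma istop_Proj:
  "istopology (\<lambda>U. U \<subseteq> Proj G B \<and> (\<forall>f. relevant G f \<longrightarrow> chart_open G B f U))"
  unfolding istopology_def
proof (intro conjI allI impI)
  fix S T f
  assume "S \<subseteq> Proj G B \<and> (\<forall>f. relevant G f \<longrightarrow> chart_open G B f S)"
     "T \<subseteq> Proj G B \<and> (\<forall>f. relevant G f \<longrightarrow> chart_open G B f T)" "relevant G f"
  then have "openin (pullback_topology {p \<in> Proj G B. f \<notin> p} (chart G f) (Spec (loc_piece G f 0)))
      ({p \<in> S. f \<notin> p} \<inter> {p \<in> T. f \<notin> p})"
    by (intro openin_Int) (simp_all add: chart_open_def)
  moreover have "{p \<in> S. f \<notin> p} \<inter> {p \<in> T. f \<notin> p} = {p \<in> S \<inter> T. f \<notin> p}" by auto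
  ultimately show "chart_open G B f (S \<inter> T)" unfolding chart_open_def by simp
next
  fix K f
  assume a: "\<forall>U\<in>K. U \<subseteq> Proj G B \<and> (\<forall>f. relevant G f \<longrightarrow> chart_open G B f U)" "relevant G f"
  have "{p \<in> \<Union>K. f \<notin> p} = (\<Union>U\<in>K. {p \<in> U. f \<notin> p})" by auto
  moreover have "openin (pullback_topology {p \<in> Proj G B. f \<notin> p} (chart G f) (Spec (loc_piece G f 0)))
      (\<Union>U\<in>K. {p \<in> U. f \<notin> p})"
    using a by (intro openin_Union) (auto simp: chart_open_def)
  ultimately show "chart_open G B f (\<Union>K)" unfolding chart_open_def by simp
qed blast+

lemma openin_Proj:
  "openin (Proj_topology G B) U \<longleftrightarrow>
     U \<subseteq> Proj G B \<and> (\<forall>f. relevant G f \<longrightarrow> chart_open G B f U)"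
  by (simp add: Proj_topology_def istop_Proj topology_inverse')

context graded_ring
begin

lemma power_hom: "homogeneous G x \<Longrightarrow> homogeneous G (x ^ n)"
  by (induction n) (auto simp: homogeneous_def intro: one_in_piece mult_in_piece)

lemma mult_hom: "homogeneous G x \<Longrightarrow> homogeneous G y \<Longrightarrow> homogeneous G (x * y)"
  by (auto simp: homogeneous_def intro: mult_in_piece)

lemma decomp_single: "x \<in> G d \<Longrightarrow> homogeneous_decomposition G x (\<lambda>e. if e = d then x else 0)"
proof -
  assume x: "x \<in> G d"
  have *: "{e. (if e = d then x else 0) \<noteq> 0} = (if x = 0 then {} else {d})" by auto
  show ?thesis unfolding homogeneous_decomposition_def * using x by (auto simp: zero_in_piece)
qed

lemma ex_decomp: obtains c where "homogeneous_decomposition G x c"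
  using direct_sum by blast

lemma decomp_unique: "homogeneous_decomposition G x c \<Longrightarrow> homogeneous_decomposition G x c' \<Longrightarrow> c = c'"
  using direct_sum by blast

lemma decomp_mult:
  assumes "a \<in> G d" "homogeneous_decomposition G x c"
  shows "homogeneous_decomposition G (a * x) (\<lambda>e. a * c (e - d))"
proof -
  have s: "{e. a * c (e - d) \<noteq> 0} \<subseteq> (\<lambda>e. e + d) ` {e. c e \<noteq> 0}"
    by (auto intro!: image_eqI[of _ "(\<lambda>e. e + d)" "_ - d"])
  have f: "finite {e. c e \<noteq> 0}" using assms(2) by (simp add: homogeneous_decomposition_def)
  have "(\<Sum>e | a * c (e - d) \<noteq> 0. a * c (e - d)) = (\<Sum>e\<in>(\<lambda>e. e + d) ` {e. c e \<noteq> 0}. a * c (e - d))"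
    using s f by (intro sum.mono_neutral_left) auto
  also have "\<dots> = (\<Sum>e | c e \<noteq> 0. a * c e)"
    by (subst sum.reindex) (auto simp: inj_on_def)
  also have "\<dots> = a * x" using assms(2) by (simp add: homogeneous_decomposition_def sum_distrib_left)
  finally have 1: "a * x = (\<Sum>e | a * c (e - d) \<noteq> 0. a * c (e - d))" by simp
  moreover have "a * c (e - d) \<in> G e" for e
    using mult_in_piece[OF assms(1), of "c (e-d)" "e-d"] assms(2)
    by (simp add: homogeneous_decomposition_def)
  moreover have "finite {e. a * c (e - d) \<noteq> 0}" using s f finite_subset by blast
  ultimately show ?thesis unfolding homogeneous_decomposition_def by blast
qed

lemma D_prime_power:
  assumes "D_prime_ideal G p" "homogeneous G f" "f \<notin> p" shows "f ^ n \<notin> p"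
proof (induction n)
  case 0
  have "is_ideal p" "p \<noteq> UNIV" using assms by (auto simp: D_prime_ideal_def graded_ideal_def)
  then show ?case using idl.subspace_scale[of p 1] by auto
next
  case (Suc n) then show ?case using assms power_hom[OF assms(2), of n]
    unfolding D_prime_ideal_def by auto
qed

lemma D_prime_mult:
  assumes "D_prime_ideal G p" "homogeneous G f" "homogeneous G g"
  shows "f * g \<in> p \<longleftrightarrow> f \<in> p \<or> g \<in> p"
  using assms unfolding D_prime_ideal_def graded_ideal_def
  by (metis idl.subspace_scale mult.commute)

end


context conical_ring
begin

lemma hom_factor:
  assumes "a \<in> G d" "a * b \<in> G c" "a \<noteq> 0"
  shows "b \<in> G (c - d)"
proof -
  obtain cb where cb: "homogeneous_decomposition G b cb" using ex_decomp .
  have "(\<lambda>e. a * cb (e - d)) = (\<lambda>e. if e = c then a * b else 0)"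
    using decomp_mult[OF assms(1) cb] decomp_single[OF assms(2)] by (rule decomp_unique)
  then have "a * cb (c - d) = a * b" by (auto dest: fun_cong[of _ _ c])
  with assms(3) have "cb (c - d) = b" by simp
  with cb show ?thesis unfolding homogeneous_decomposition_def by metis
qed

lemma loc_piece_mult:
  assumes "x \<in> loc_piece G f e" "y \<in> loc_piece G f e'"
  shows "x * y \<in> loc_piece G f (e + e')"
proof -
  obtain a n d1 d2 where x: "x = Fract a (f ^ n)" "a \<in> G d1" "f ^ n \<in> G d2" "e = d1 - d2"
    using assms unfolding loc_piece_def by blast
  obtain b m d3 d4 where y: "y = Fract b (f ^ m)" "b \<in> G d3" "f ^ m \<in> G d4" "e' = d3 - d4"
    using assms unfolding loc_piece_def by blast
  have "x * y = Fract (a * b) (f ^ (n + m))" using x y by (simp add: power_add)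
  moreover have "a * b \<in> G (d1 + d3)" "f ^ (n + m) \<in> G (d2 + d4)"
    using x y mult_in_piece by (simp_all add: power_add)
  moreover have "e + e' = (d1 + d3) - (d2 + d4)" using x y by simp
  ultimately show ?thesis unfolding loc_piece_def by blast
qed

lemma one_loc_piece: "1 \<in> loc_piece G f 0"
  unfolding loc_piece_def using one_in_piece
  by (intro CollectI exI[of _ 1] exI[of _ 0]) (simp add: One_fract_def)

lemma mult_closed_loc: "mult_closed (loc_piece G f 0)"
  unfolding mult_closed_def using one_loc_piece loc_piece_mult[of _ f 0 _ 0] by simp

lemma unit_degreesE:
  assumes "e \<in> unit_degrees G f" "homogeneous G f" "f \<noteq> 0"
  obtains u v where "u \<in> loc_piece G f e" "v \<in> loc_piece G f (- e)" "u * v = 1"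
proof -
  obtain u v where uv: "u \<in> loc_piece G f e" "v \<in> loc f" "u * v = 1"
    using assms unfolding unit_degrees_def by blast
  obtain a n d d' where a: "u = Fract a (f ^ n)" "a \<in> G d" "f ^ n \<in> G d'" "e = d - d'"
    using uv unfolding loc_piece_def by blast
  obtain b m where b: "v = Fract b (f ^ m)" using uv unfolding loc_def by blast
  obtain dm where dm: "f ^ m \<in> G dm" using power_hom[OF assms(2)] unfolding homogeneous_def by blast
  have ab: "a * b = f ^ n * f ^ m" using uv(3) assms(3) a b by (simp add: One_fract_def eq_fract)
  moreover have "f ^ n * f ^ m \<in> G (d' + dm)" using a dm mult_in_piece by blast
  moreover have "a \<noteq> 0" using ab assms(3) by auto
  ultimately have "b \<in> G (d' + dm - d)" using hom_factor a by metis
  moreover have "- e = (d' + dm - d) - dm" using a by simp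
  ultimately have "v \<in> loc_piece G f (- e)" unfolding loc_piece_def using b dm by blast
  with uv that show ?thesis by blast
qed

lemma unit_degreesI:
  assumes "u \<in> loc_piece G f e" "v \<in> loc_piece G f e'" "u * v = 1"
  shows "e \<in> unit_degrees G f"
  using assms unfolding unit_degrees_def loc_piece_def loc_def by blast

lemma unit_degrees_0: "0 \<in> unit_degrees G f"
  using unit_degreesI[OF one_loc_piece one_loc_piece] by simp

lemma unit_degrees_diff:
  assumes "e \<in> unit_degrees G f" "e' \<in> unit_degrees G f" "homogeneous G f" "f \<noteq> 0"
  shows "e - e' \<in> unit_degrees G f"
proof -
  obtain u v where u: "u \<in> loc_piece G f e" "v \<in> loc_piece G f (- e)" "u * v = 1"
    using unit_degreesE assms by metis
  obtain u' v' where u': "u' \<in> loc_piece G f e'" "v' \<in> loc_piece G f (- e')" "u' * v' = 1"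
    using unit_degreesE assms by metis
  have "(u * v') * (v * u') = (u * v) * (u' * v')" by simp
  then have "(u * v') * (v * u') = 1" using u u' by simp
  from unit_degreesI[OF loc_piece_mult[OF u(1) u'(2)] loc_piece_mult[OF u(2) u'(1)] this]
  show ?thesis by simp
qed

lemma chart_iff:
  assumes p: "D_prime_ideal G p" "f \<notin> p" and f: "homogeneous G f"
    and a: "a \<in> G d" "f ^ n \<in> G d"
  shows "Fract a (f ^ n) \<in> chart G f p \<longleftrightarrow> a \<in> p"
proof
  have "Fract a (f ^ n) \<in> loc_piece G f 0" unfolding loc_piece_def using a by force
  then show "a \<in> p \<Longrightarrow> Fract a (f ^ n) \<in> chart G f p" unfolding chart_def by blast
  have f0: "f \<noteq> 0" using p idl.subspace_0 by (auto simp: D_prime_ideal_def graded_ideal_def)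
  assume "Fract a (f ^ n) \<in> chart G f p"
  then obtain c m where c: "c \<in> p" "Fract a (f ^ n) = Fract c (f ^ m)" unfolding chart_def by blast
  then have "a * f ^ m = c * f ^ n" using f0 by (simp add: eq_fract)
  also have "c * f ^ n \<in> p" using c p idl.subspace_scale[of p c "f ^ n"]
    by (simp add: D_prime_ideal_def graded_ideal_def mult.commute)
  finally show "a \<in> p" using D_prime_mult[OF p(1)] D_prime_power[OF p(1) f p(2)]
      power_hom[OF f] a(1) homogeneous_def by metis
qed

lemma loc_pieceE:
  assumes "x \<in> loc_piece G f 0"
  obtains a n d where "x = Fract a (f ^ n)" "a \<in> G d" "f ^ n \<in> G d"
  using assms unfolding loc_piece_def by auto

lemma prime_chart:
  assumes p: "D_prime_ideal G p" "f \<notin> p" and f: "homogeneous G f"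
  shows "prime_ideal_of (loc_piece G f 0) (chart G f p)"
proof -
  have I: "is_ideal p" using p by (simp add: D_prime_ideal_def graded_ideal_def)
  have f0: "f \<noteq> 0" using p I idl.subspace_0 by auto
  note ci = chart_iff[OF p f]
  have sub: "chart G f p \<subseteq> loc_piece G f 0" by (simp add: chart_def)
  have 1: "1 \<notin> chart G f p"
    using ci[of 1 0 0] one_in_piece D_prime_power[OF p(1) f p(2), of 0] by (simp add: One_fract_def)
  have 0: "0 \<in> chart G f p"
    using ci[of 0 0 0] one_in_piece zero_in_piece idl.subspace_0[OF I] by (simp add: Zero_fract_def)
  have m: "x * y \<in> chart G f p \<longleftrightarrow> x \<in> chart G f p \<or> y \<in> chart G f p"
    if xy: "x \<in> loc_piece G f 0" "y \<in> loc_piece G f 0" for x y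
  proof -
    obtain a n d where a: "x = Fract a (f ^ n)" "a \<in> G d" "f ^ n \<in> G d" using xy by (blast elim: loc_pieceE)
    obtain b m e where b: "y = Fract b (f ^ m)" "b \<in> G e" "f ^ m \<in> G e" using xy by (blast elim: loc_pieceE)
    have "x * y = Fract (a * b) (f ^ (n + m))" using a b by (simp add: power_add)
    moreover have "Fract (a * b) (f ^ (n + m)) \<in> chart G f p \<longleftrightarrow> a * b \<in> p"
      using a b by (intro ci[of _ "d + e"]) (auto simp: power_add intro: mult_in_piece)
    ultimately show ?thesis using ci[OF a(2,3)] ci[OF b(2,3)] a(1) b(1) D_prime_mult[OF p(1), of a b] a(2) b(2)
      by (auto simp: homogeneous_def)
  qed
  have s: "x + y \<in> chart G f p" if xy: "x \<in> chart G f p" "y \<in> chart G f p" for x y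
  proof -
    obtain a n d where a: "x = Fract a (f ^ n)" "a \<in> G d" "f ^ n \<in> G d" using xy sub by (blast elim: loc_pieceE)
    obtain b m e where b: "y = Fract b (f ^ m)" "b \<in> G e" "f ^ m \<in> G e" using xy sub by (blast elim: loc_pieceE)
    have ab: "a \<in> p" "b \<in> p" using xy a b ci by auto
    have "x + y = Fract (a * f ^ m + b * f ^ n) (f ^ (n + m))" using a b f0 by (simp add: power_add)
    moreover have "a * f ^ m + b * f ^ n \<in> p"
      using ab I by (metis idl.subspace_add idl.subspace_scale mult.commute)
    moreover have "a * f ^ m + b * f ^ n \<in> G (d + e)" "f ^ (n + m) \<in> G (d + e)"
      using a b mult_in_piece[of a d "f^m" e] mult_in_piece[of b e "f^n" d] mult_in_piece[of "f^n" d "f^m" e]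
      by (auto simp: power_add add.commute mult.commute intro: add_in_piece)
    ultimately show ?thesis using ci by metis
  qed
  show ?thesis unfolding prime_ideal_of_def using sub 0 1 m s by blast
qed

lemma relevant_power:
  assumes f: "relevant G f" and g: "homogeneous G g"
  obtains k e where "k > 0" "g ^ k \<in> G e" "e \<in> unit_degrees G f"
proof -
  obtain d where d: "g \<in> G d" using g homogeneous_def by metis
  define D where "D k = (\<Sum>i<k. d)" for k :: nat
  have gD: "g ^ k \<in> G (D k)" for k
    by (induction k) (auto simp: D_def one_in_piece add.commute intro: mult_in_piece d)
  have Dadd: "D (k + l) = D k + D l" for k l by (induction l) (auto simp: D_def algebra_simps)
  let ?c = "\<lambda>d. (\<lambda>e. d + e) ` unit_degrees G f"
  have "finite (range (\<lambda>k. ?c (D k)))" using f unfolding relevant_def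
    by (auto elim!: finite_subset[rotated])
  then have "\<not> inj (\<lambda>k. ?c (D k))" using finite_imageD infinite_UNIV_nat by blast
  then obtain k l where "k < l" "?c (D k) = ?c (D l)" unfolding inj_def by (metis nat_neq_iff)
  moreover have "D l \<in> ?c (D l)" using unit_degrees_0[of f] by (intro image_eqI[of _ _ 0]) auto
  ultimately obtain h where h: "h \<in> unit_degrees G f" "D l = D k + h" by blast
  have "D l = D k + D (l - k)" using Dadd[of k "l - k"] \<open>k < l\<close> by simp
  with h have "D (l - k) \<in> unit_degrees G f" by simp
  with \<open>k < l\<close> show ?thesis using that[of "l - k", OF _ gD] by simp
qed

lemma key:
  assumes f: "relevant G f" and g: "homogeneous G g"
  obtains x where "x \<in> loc_piece G f 0"
    "\<And>p. D_prime_ideal G p \<Longrightarrow> f \<notin> p \<Longrightarrow> x \<in> chart G f p \<longleftrightarrow> g \<in> p"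
proof -
  have hf: "homogeneous G f" "f \<noteq> 0" using f by (auto simp: relevant_def)
  obtain k e where k: "k > 0" "g ^ k \<in> G e" "e \<in> unit_degrees G f" using relevant_power[OF f g] .
  obtain u v where uv: "u \<in> loc_piece G f e" "v \<in> loc_piece G f (- e)" "u * v = 1"
    using unit_degreesE[OF k(3) hf] .
  obtain a n d d' where a: "u = Fract a (f ^ n)" "a \<in> G d" "f ^ n \<in> G d'" "e = d - d'"
    using uv unfolding loc_piece_def by blast
  obtain b m c c' where b: "v = Fract b (f ^ m)" "b \<in> G c" "f ^ m \<in> G c'" "- e = c - c'"
    using uv unfolding loc_piece_def by blast
  have ab: "a * b = f ^ (n + m)" using uv(3) hf a b by (simp add: One_fract_def eq_fract power_add)
  have "c' = e + c" using b(4) by (metis add_minus_cancel diff_add_cancel minus_add_distrib minus_minus uminus_add_conv_diff)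
  then have h: "g ^ k * b \<in> G c'" using mult_in_piece[OF k(2) b(2)] by simp
  let ?x = "Fract (g ^ k * b) (f ^ m)"
  have "?x \<in> loc_piece G f 0" unfolding loc_piece_def using h b(3) by force
  moreover have "?x \<in> chart G f p \<longleftrightarrow> g \<in> p" if p: "D_prime_ideal G p" "f \<notin> p" for p
  proof -
    have "b \<notin> p" using D_prime_mult[OF p(1), of a b] D_prime_power[OF p(1) hf(1) p(2)] a b ab
      by (auto simp: homogeneous_def)
    then have "g ^ k * b \<in> p \<longleftrightarrow> g ^ k \<in> p" using D_prime_mult[OF p(1) power_hom[OF g]] b(2)
      by (auto simp: homogeneous_def)
    also have "\<dots> \<longleftrightarrow> g \<in> p"
    proof
      show "g ^ k \<in> p \<Longrightarrow> g \<in> p" using D_prime_power[OF p(1) g] by blast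
      assume "g \<in> p"
      moreover have "g ^ k = g ^ (k - 1) * g" using k(1) by (metis Suc_diff_1 power_Suc2)
      ultimately show "g ^ k \<in> p" using p idl.subspace_scale unfolding D_prime_ideal_def graded_ideal_def by metis
    qed
    finally show ?thesis using chart_iff[OF p hf(1) h b(3)] by simp
  qed
  ultimately show ?thesis using that by blast
qed

lemma chart_open_compl:
  assumes f: "relevant G f" and E: "\<forall>g\<in>E. homogeneous G g"
  shows "chart_open G B f (Proj G B - V_plus G B E)"
proof -
  have "\<forall>g\<in>E. \<exists>x. x \<in> loc_piece G f 0 \<and> (\<forall>p. D_prime_ideal G p \<longrightarrow> f \<notin> p \<longrightarrow> (x \<in> chart G f p \<longleftrightarrow> g \<in> p))"
    using key[OF f] E by metis
  then obtain X where X: "\<forall>g\<in>E. X g \<in> loc_piece G f 0 \<and> (\<forall>p. D_prime_ideal G p \<longrightarrow> f \<notin> p \<longrightarrow> (X g \<in> chart G f p \<longleftrightarrow> g \<in> p))"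
    by metis
  have hf: "homogeneous G f" using f by (simp add: relevant_def)
  let ?W = "{q. prime_ideal_of (loc_piece G f 0) q \<and> \<not> X ` E \<subseteq> q}"
  have "openin (Spec (loc_piece G f 0)) ?W"
    unfolding openin_Spec[OF mult_closed_loc] using X by blast
  moreover have "{p \<in> Proj G B - V_plus G B E. f \<notin> p} = chart G f -` ?W \<inter> {p \<in> Proj G B. f \<notin> p}"
    using X prime_chart[OF _ _ hf] unfolding Proj_def V_plus_def by auto
  ultimately show ?thesis unfolding chart_open_def openin_pullback_topology by blast
qed

lemma chart_open_imp:
  assumes F: "\<forall>f\<in>F. relevant G f" and cover: "\<forall>p\<in>Proj G B. \<exists>f\<in>F. f \<notin> p"
    and U: "U \<subseteq> Proj G B" "\<forall>f\<in>F. chart_open G B f U"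
  shows "U = Proj G B - V_plus G B {g. homogeneous G g \<and> (\<forall>p\<in>Proj G B - U. g \<in> p)}"
    (is "_ = _ - V_plus G B ?E")
proof
  show "Proj G B - V_plus G B ?E \<subseteq> U" by (auto simp: V_plus_def)
  show "U \<subseteq> Proj G B - V_plus G B ?E"
  proof
    fix p assume pU: "p \<in> U"
    then have p: "D_prime_ideal G p" using U by (auto simp: Proj_def)
    obtain f where f: "f \<in> F" "f \<notin> p" using cover pU U by blast
    then have hf: "homogeneous G f" "f \<noteq> 0" using F by (auto simp: relevant_def)
    have "chart_open G B f U" using U(2) f(1) by simp
    then obtain W where W: "openin (Spec (loc_piece G f 0)) W"
      "{p \<in> U. f \<notin> p} = chart G f -` W \<inter> {p \<in> Proj G B. f \<notin> p}"
      unfolding chart_open_def openin_pullback_topology by (elim exE conjE)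
    obtain J where J1: "J \<subseteq> loc_piece G f 0"
      and "W = {q. prime_ideal_of (loc_piece G f 0) q \<and> \<not> J \<subseteq> q}"
      using W(1) unfolding openin_Spec[OF mult_closed_loc] by (elim exE conjE)
    with W(2) have J: "{p \<in> U. f \<notin> p} =
      chart G f -` {q. prime_ideal_of (loc_piece G f 0) q \<and> \<not> J \<subseteq> q} \<inter> {p \<in> Proj G B. f \<notin> p}"
      by simp
    have "p \<in> {p \<in> U. f \<notin> p}" using pU f by simp
    then have "\<not> J \<subseteq> chart G f p" unfolding J by simp
    then obtain x where x: "x \<in> J" "x \<notin> chart G f p" by blast
    then obtain a n d where a: "x = Fract a (f ^ n)" "a \<in> G d" "f ^ n \<in> G d" using J1 by (blast elim: loc_pieceE)
    have ah: "homogeneous G a" using a by (auto simp: homogeneous_def)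
    have "a \<notin> p" using x a chart_iff[OF p f(2) hf(1) a(2,3)] by simp
    then have 1: "f * a \<notin> p" using D_prime_mult[OF p hf(1) ah] f by simp
    have "f * a \<in> p'" if "p' \<in> Proj G B - U" for p'
    proof (cases "f \<in> p'")
      case True
      with that show ?thesis using D_prime_mult[OF _ hf(1) ah] by (auto simp: Proj_def)
    next
      case False
      have p': "D_prime_ideal G p'" using that by (simp add: Proj_def)
      have "p' \<notin> {p \<in> U. f \<notin> p}" using that by simp
      then have "J \<subseteq> chart G f p'" unfolding J using that False prime_chart[OF p' False hf(1)] by auto
      then have "a \<in> p'" using x a chart_iff[OF p' False hf(1) a(2,3)] by auto
      then show ?thesis using D_prime_mult[OF p' hf(1) ah] by simp
    qed
    then have "f * a \<in> ?E" using mult_hom[OF hf(1) ah] by simp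
    with 1 show "p \<in> Proj G B - V_plus G B ?E" using pU U by (auto simp: V_plus_def)
  qed
qed

lemma cover_all: "p \<in> Proj G B \<Longrightarrow> \<exists>f. relevant G f \<and> f \<notin> p"
proof (rule ccontr)
  assume p: "p \<in> Proj G B" "\<nexists>f. relevant G f \<and> f \<notin> p"
  then have "S_plus G \<subseteq> p" unfolding S_plus_def
    by (intro idl.span_minimal) (auto simp: Proj_def D_prime_ideal_def graded_ideal_def)
  then show False using p B_subset by (auto simp: Proj_def)
qed

lemma relevant_mult:
  assumes f: "relevant G f" and b: "homogeneous G b" "b \<noteq> 0"
  shows "relevant G (f * b)"
proof -
  have hf: "homogeneous G f" "f \<noteq> 0" using f by (auto simp: relevant_def)
  have h: "homogeneous G (f * b)" "f * b \<noteq> 0" using hf b mult_hom by auto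
  have piece: "loc_piece G f e \<subseteq> loc_piece G (f * b) e" for e
  proof
    fix x assume "x \<in> loc_piece G f e"
    then obtain a n d d' where a: "x = Fract a (f ^ n)" "a \<in> G d" "f ^ n \<in> G d'" "e = d - d'"
      unfolding loc_piece_def by blast
    obtain c where c: "b ^ n \<in> G c" using power_hom[OF b(1)] homogeneous_def by metis
    have "x = Fract (a * b ^ n) ((f * b) ^ n)" using a b hf by (simp add: eq_fract power_mult_distrib)
    moreover have "a * b ^ n \<in> G (d + c)" "(f * b) ^ n \<in> G (d' + c)"
      using a c mult_in_piece by (auto simp: power_mult_distrib)
    moreover have "e = (d + c) - (d' + c)" using a by simp
    ultimately show "x \<in> loc_piece G (f * b) e" unfolding loc_piece_def by blast
  qed
  let ?H = "unit_degrees G f" and ?K = "unit_degrees G (f * b)"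
  have HK: "?H \<subseteq> ?K"
    using unit_degreesE[OF _ hf] unit_degreesI piece by (metis subset_iff)
  have eq: "(\<lambda>e. d + e) ` ?K = (\<lambda>x. \<Union>s\<in>x. (\<lambda>e. s + e) ` ?K) ((\<lambda>e. d + e) ` ?H)" for d
  proof -
    have "d + h + e \<in> (\<lambda>e. d + e) ` ?K" if "h \<in> ?H" "e \<in> ?K" for h e
      using unit_degrees_diff[OF that(2) unit_degrees_diff[OF unit_degrees_0 _ h, of h] h] HK that
      by (intro image_eqI[of _ _ "h + e"]) (auto simp: algebra_simps)
    moreover have "0 \<in> ?H" by (rule unit_degrees_0)
    ultimately show ?thesis by force
  qed
  have "finite (range (\<lambda>d. (\<lambda>e. d + e) ` ?H))" using f by (simp add: relevant_def)
  moreover have "range (\<lambda>d. (\<lambda>e. d + e) ` ?K) \<subseteq>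
      (\<lambda>x. \<Union>s\<in>x. (\<lambda>e. s + e) ` ?K) ` range (\<lambda>d. (\<lambda>e. d + e) ` ?H)"
    by (rule image_subsetI, subst eq, intro imageI rangeI)
  ultimately have "finite (range (\<lambda>d. (\<lambda>e. d + e) ` ?K))"
    by (meson finite_imageI finite_subset)
  with h show ?thesis by (simp add: relevant_def)
qed

lemma cover_graded:
  assumes "graded_ideal G B" "p \<in> Proj G B"
  shows "\<exists>f\<in>B. relevant G f \<and> f \<notin> p"
proof -
  obtain f where f: "relevant G f" "f \<notin> p" using cover_all[OF assms(2)] by blast
  have p: "D_prime_ideal G p" "\<not> B \<subseteq> p" using assms by (auto simp: Proj_def)
  have I: "is_ideal p" using p by (simp add: D_prime_ideal_def graded_ideal_def)
  obtain x where x: "x \<in> B" "x \<notin> p" using p by blast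
  obtain c where c: "homogeneous_decomposition G x c" using ex_decomp .
  have "\<exists>d. c d \<notin> p"
  proof (rule ccontr)
    assume "\<nexists>d. c d \<notin> p"
    then have "(\<Sum>d | c d \<noteq> 0. c d) \<in> p" by (intro idl.subspace_sum[OF I]) auto
    with x c show False by (simp add: homogeneous_decomposition_def)
  qed
  then obtain d where d: "c d \<notin> p" by blast
  have cB: "c d \<in> B" using assms(1) x c by (auto simp: graded_ideal_def)
  have ch: "homogeneous G (c d)" using c by (auto simp: homogeneous_decomposition_def homogeneous_def)
  have c0: "c d \<noteq> 0" using d idl.subspace_0[OF I] by auto
  have "f * c d \<in> B" using cB ideal_B idl.subspace_scale by blast
  moreover have "f * c d \<notin> p" using D_prime_mult[OF p(1) _ ch, of f] f d by (auto simp: relevant_def)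
  ultimately show ?thesis using relevant_mult[OF f(1) ch c0] by blast
qed

lemma openin_Proj_cover:
  assumes F: "\<forall>f\<in>F. relevant G f" and cover: "\<forall>p\<in>Proj G B. \<exists>f\<in>F. f \<notin> p"
  shows "openin (Proj_topology G B) U \<longleftrightarrow> U \<subseteq> Proj G B \<and> (\<forall>f\<in>F. chart_open G B f U)"
proof
  assume "openin (Proj_topology G B) U"
  with F show "U \<subseteq> Proj G B \<and> (\<forall>f\<in>F. chart_open G B f U)" by (auto simp: openin_Proj)
next
  assume U: "U \<subseteq> Proj G B \<and> (\<forall>f\<in>F. chart_open G B f U)"
  have "U = Proj G B - V_plus G B {g. homogeneous G g \<and> (\<forall>p\<in>Proj G B - U. g \<in> p)}"
    using chart_open_imp[OF F cover] U by blast
  then have "chart_open G B f U" if "relevant G f" for f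
    using chart_open_compl[OF that, of "{g. homogeneous G g \<and> (\<forall>p\<in>Proj G B - U. g \<in> p)}"] by simp
  with U show "openin (Proj_topology G B) U" by (simp add: openin_Proj)
qed

lemma openin_Proj_graded:
  assumes "graded_ideal G B"
  shows "openin (Proj_topology G B) U \<longleftrightarrow>
    U \<subseteq> Proj G B \<and> (\<forall>f\<in>B. relevant G f \<longrightarrow> chart_open G B f U)"
proof -
  have "\<forall>p\<in>Proj G B. \<exists>f\<in>{f \<in> B. relevant G f}. f \<notin> p"
    using cover_graded[OF assms] by blast
  from openin_Proj_cover[OF _ this, of U] show ?thesis by auto
qed

lemma openin_Proj_iff:
  "openin (Proj_topology G B) U \<longleftrightarrow>
    (\<exists>E. (\<forall>g\<in>E. homogeneous G g) \<and> U = Proj G B - V_plus G B E)"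
proof
  assume U: "openin (Proj_topology G B) U"
  then show "\<exists>E. (\<forall>g\<in>E. homogeneous G g) \<and> U = Proj G B - V_plus G B E"
    using chart_open_imp[of "{f. relevant G f}" U] cover_all
    by (intro exI[of _ "{g. homogeneous G g \<and> (\<forall>p\<in>Proj G B - U. g \<in> p)}"]) (auto simp: openin_Proj)
next
  assume "\<exists>E. (\<forall>g\<in>E. homogeneous G g) \<and> U = Proj G B - V_plus G B E"
  then show "openin (Proj_topology G B) U"
    by (auto simp: openin_Proj intro: chart_open_compl)
qed

lemma closedin_Proj_iff:
  "closedin (Proj_topology G B) Z \<longleftrightarrow>
    (\<exists>E. (\<forall>g\<in>E. homogeneous G g) \<and> Z = V_plus G B E)"
proof -
  have "1 \<notin> p" if "p \<in> Proj G B" for p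
    using that idl.subspace_scale[of p 1] by (auto simp: Proj_def D_prime_ideal_def graded_ideal_def)
  then have "Proj G B = Proj G B - V_plus G B {1}" by (auto simp: V_plus_def)
  then have "openin (Proj_topology G B) (Proj G B)"
    unfolding openin_Proj_iff using one_in_piece by (intro exI[of _ "{1}"]) (auto simp: homogeneous_def)
  then have t: "topspace (Proj_topology G B) = Proj G B"
    by (auto simp: openin_Proj topspace_def)
  have "V_plus G B E \<subseteq> Proj G B" for E by (auto simp: V_plus_def)
  then show ?thesis unfolding closedin_def t openin_Proj_iff by blast
qed

end

end

theory Submission
  imports Defs
begin

text \<open>
  Part (a) is the graded form of Krull's theorem that a radical ideal is an intersection of
  primes. An element no power of which lies in a graded ideal \<open>I\<close> is avoided by some
  \<open>D\<close>-prime ideal containing \<open>I\<close>, namely by a maximal element among the graded ideals containing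
  \<open>I\<close> and no power of that element (\<open>separating_D_prime\<close>). As \<open>D\<close>-prime ideals are graded, this
  separates every \<open>f \<in> B\<close> outside the radical ideal \<open>(E)\<close> from \<open>(E)\<close>, through some homogeneous
  component of \<open>f\<close>; the resulting \<open>D\<close>-prime ideal is a point of Proj since it misses the element
  \<open>f\<close> of \<open>B\<close>. On the other side of the equation nothing happens: \<open>(E) \<subseteq> B\<close>, so the restriction of
  \<open>(E)\<close> to \<open>B\<close> and its radical in \<open>B\<close> are both \<open>(E)\<close>.

  For part (b), let \<open>J\<close> be the intersection of the primes in \<open>Y\<close>. It is graded, so the
  description of the closed sets of Proj shows that the closure of \<open>Y\<close> is the locus of \<open>J\<close>.
  Cutting down to \<open>J \<inter> B\<close> does not enlarge this locus: a point \<open>p\<close> containing \<open>J \<inter> B\<close> contains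
  the products of \<open>J\<close> and \<open>B\<close>, but not \<open>B\<close>, hence it contains \<open>J\<close>
  (\<open>graded_ideal_subset_of_Int_subset\<close>).
\<close>

section \<open>Graded ideals\<close>

context graded_ring
begin

lemma decomposition_iff_sum:
  assumes "\<And>d. c d \<in> G d" "finite A" "\<And>d. d \<notin> A \<Longrightarrow> c d = 0"
  shows "homogeneous_decomposition G x c \<longleftrightarrow> x = sum c A"
proof -
  have s: "{d. c d \<noteq> 0} \<subseteq> A" using assms(3) by blast
  then have "sum c {d. c d \<noteq> 0} = sum c A"
    using assms(2) by (intro sum.mono_neutral_left) auto
  then show ?thesis
    using assms(1) finite_subset[OF s assms(2)] by (simp add: homogeneous_decomposition_def)
qed

lemma decomposition_add:
  assumes "homogeneous_decomposition G x c" "homogeneous_decomposition G y c'"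
  shows "homogeneous_decomposition G (x + y) (\<lambda>d. c d + c' d)"
proof -
  let ?A = "{d. c d \<noteq> 0} \<union> {d. c' d \<noteq> 0}"
  have piece: "c d \<in> G d" "c' d \<in> G d" for d
    using assms by (simp_all add: homogeneous_decomposition_def)
  have A: "finite ?A" using assms by (simp add: homogeneous_decomposition_def)
  have "x = sum c ?A" "y = sum c' ?A"
    using assms decomposition_iff_sum[OF piece(1) A, of x]
      decomposition_iff_sum[OF piece(2) A, of y] by auto
  then have "x + y = (\<Sum>d\<in>?A. c d + c' d)" by (simp add: sum.distrib)
  then show ?thesis
    using A piece by (subst decomposition_iff_sum[where A = ?A]) (auto intro: add_in_piece)
qed

lemma mem_graded_ideal_iff:
  assumes I: "graded_ideal G I" and c: "homogeneous_decomposition G x c"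
  shows "x \<in> I \<longleftrightarrow> (\<forall>d. c d \<in> I)"
proof
  assume "\<forall>d. c d \<in> I"
  then have "(\<Sum>d | c d \<noteq> 0. c d) \<in> I"
    using I by (intro idl.subspace_sum) (auto simp: graded_ideal_def)
  with c show "x \<in> I" by (simp add: homogeneous_decomposition_def)
qed (use assms in \<open>auto simp: graded_ideal_def\<close>)

text \<open>A homogeneous factor only multiplies the components of \<open>x\<close> and shifts their degrees; a general
  factor is a finite sum of homogeneous ones, which is treated by induction on its support.\<close>

lemma components_in_ideal_mult:
  assumes I: "is_ideal I"
    and x: "homogeneous_decomposition G x c" "\<forall>d. c d \<in> I"
    and ax: "homogeneous_decomposition G (a * x) c'"
  shows "c' d \<in> I"
proof -
  obtain r where r: "homogeneous_decomposition G a r" using ex_decomp .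
  have a: "a = (\<Sum>d | r d \<noteq> 0. r d)" and fin: "finite {d. r d \<noteq> 0}" and piece: "r d \<in> G d" for d
    using r by (simp_all add: homogeneous_decomposition_def)
  have "\<exists>c'. homogeneous_decomposition G (sum r A * x) c' \<and> (\<forall>d. c' d \<in> I)" if "finite A" for A
    using that
  proof (induction A)
    case empty
    have "homogeneous_decomposition G 0 (\<lambda>d. 0)"
      by (simp add: homogeneous_decomposition_def zero_in_piece)
    then show ?case using idl.subspace_0[OF I] by auto
  next
    case (insert e A)
    then obtain c' where c': "homogeneous_decomposition G (sum r A * x) c'" "\<forall>d. c' d \<in> I"
      by blast
    have "homogeneous_decomposition G (r e * x + sum r A * x) (\<lambda>d. r e * c (d - e) + c' d)"
      by (intro decomposition_add decomp_mult piece x(1) c'(1))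
    moreover have "r e * c (d - e) + c' d \<in> I" for d
      using I x(2) c'(2) by (intro idl.subspace_add idl.subspace_scale) auto
    ultimately show ?case using insert.hyps
      by (intro exI[of _ "\<lambda>d. r e * c (d - e) + c' d"]) (simp add: distrib_right)
  qed
  from this[OF fin] show ?thesis using decomp_unique[OF ax] a by metis
qed

text \<open>The elements whose components lie in the ideal generated by \<open>E\<close> form an ideal, so it is
  enough to look at the generators. Besides sets of homogeneous elements, this covers the
  enlargement of a graded ideal by one homogeneous element.\<close>

lemma graded_ideal_gen:
  assumes "\<And>x c d. x \<in> E \<Longrightarrow> homogeneous_decomposition G x c \<Longrightarrow> c d \<in> ideal_gen E"
  shows "graded_ideal G (ideal_gen E)"
proof -
  let ?I = "ideal_gen E"
  let ?T = "{x. \<forall>c. homogeneous_decomposition G x c \<longrightarrow> (\<forall>d. c d \<in> ?I)}"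
  have I: "is_ideal ?I" by (rule idl.subspace_span)
  have "is_ideal ?T"
  proof (rule idl.subspaceI)
    show "0 \<in> ?T"
      using decomp_unique[OF decomp_single[OF zero_in_piece]] idl.subspace_0[OF I] by fastforce
  next
    fix x y assume xy: "x \<in> ?T" "y \<in> ?T"
    obtain c where c: "homogeneous_decomposition G x c" using ex_decomp .
    obtain c' where c': "homogeneous_decomposition G y c'" using ex_decomp .
    have "c d + c' d \<in> ?I" for d using xy c c' by (intro idl.subspace_add[OF I]) auto
    then show "x + y \<in> ?T" using decomp_unique[OF decomposition_add[OF c c']] by fastforce
  next
    fix a x assume x: "x \<in> ?T"
    obtain c where c: "homogeneous_decomposition G x c" using ex_decomp .
    then show "a * x \<in> ?T" using components_in_ideal_mult[OF I c] x by auto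
  qed
  then have "?I \<subseteq> ?T" using assms by (intro idl.span_minimal) auto
  with I show ?thesis unfolding graded_ideal_def by blast
qed

lemma component_of_homogeneous:
  assumes "homogeneous G x" "homogeneous_decomposition G x c"
  shows "c d = x \<or> c d = 0"
proof -
  obtain e where "x \<in> G e" using assms(1) by (auto simp: homogeneous_def)
  from decomp_unique[OF assms(2) decomp_single[OF this]] show ?thesis by simp
qed

lemma graded_ideal_gen_homogeneous:
  assumes "\<forall>x\<in>E. homogeneous G x"
  shows "graded_ideal G (ideal_gen E)"
proof (rule graded_ideal_gen)
  fix x c d assume "x \<in> E" "homogeneous_decomposition G x c"
  then show "c d \<in> ideal_gen E"
    using component_of_homogeneous assms idl.span_base idl.span_zero by metis
qed

lemma graded_ideal_gen_insert:
  assumes I: "graded_ideal G I" and f: "homogeneous G f"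
  shows "graded_ideal G (ideal_gen (insert f I))"
proof (rule graded_ideal_gen)
  fix x c d assume x: "x \<in> insert f I" and c: "homogeneous_decomposition G x c"
  show "c d \<in> ideal_gen (insert f I)"
  proof (cases "x = f")
    case True
    then show ?thesis using component_of_homogeneous[OF f] c idl.span_base idl.span_zero
      by (metis insertI1)
  next
    case False
    then have "c d \<in> I" using x c mem_graded_ideal_iff[OF I] by auto
    then show ?thesis by (simp add: idl.span_base)
  qed
qed

lemma graded_ideal_Inter:
  assumes "\<And>I. I \<in> \<I> \<Longrightarrow> graded_ideal G I"
  shows "graded_ideal G (\<Inter>\<I>)"
  using assms unfolding graded_ideal_def by (auto intro!: idl.subspace_Inter)

lemma graded_ideal_Union_chain:
  assumes C: "\<C> \<noteq> {}" "subset.chain {I. graded_ideal G I} \<C>"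
  shows "graded_ideal G (\<Union>\<C>)"
proof -
  have gr: "graded_ideal G I" if "I \<in> \<C>" for I using C that by (auto simp: subset.chain_def)
  then have I: "is_ideal I" if "I \<in> \<C>" for I using that by (auto simp: graded_ideal_def)
  have "is_ideal (\<Union>\<C>)"
  proof (rule idl.subspaceI)
    show "0 \<in> \<Union>\<C>" using C(1) I idl.subspace_0 by blast
  next
    fix x y assume "x \<in> \<Union>\<C>" "y \<in> \<Union>\<C>"
    then obtain J K where JK: "J \<in> \<C>" "x \<in> J" "K \<in> \<C>" "y \<in> K" by blast
    then have "J \<subseteq> K \<or> K \<subseteq> J" using C(2) by (auto simp: subset.chain_def)
    then show "x + y \<in> \<Union>\<C>" using JK I idl.subspace_add by blast
  next
    fix a x assume "x \<in> \<Union>\<C>"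
    then show "a * x \<in> \<Union>\<C>" using I idl.subspace_scale by blast
  qed
  then show ?thesis using gr unfolding graded_ideal_def by blast
qed

section \<open>Separation by \<open>D\<close>-prime ideals\<close>

text \<open>Krull's argument: if \<open>f, g \<notin> p\<close>, then by maximality of \<open>p\<close> both \<open>p + (f)\<close> and \<open>p + (g)\<close>
  contain a power of \<open>h\<close>, and the product of these powers lies in \<open>p + (f g)\<close>, so \<open>f g \<notin> p\<close>.
  Maximality among graded ideals only gives this for homogeneous \<open>f\<close> and \<open>g\<close>, which is what \<open>D\<close>-primality asks
  for.\<close>

lemma separating_D_prime:
  assumes I: "graded_ideal G I" and h: "\<And>n. h ^ n \<notin> I"
  obtains p where "D_prime_ideal G p" "I \<subseteq> p" "h \<notin> p"
proof -
  define \<A> where "\<A> = {J. graded_ideal G J \<and> I \<subseteq> J \<and> (\<forall>n. h ^ n \<notin> J)}"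
  have "\<exists>p\<in>\<A>. \<forall>J\<in>\<A>. p \<subseteq> J \<longrightarrow> J = p"
  proof (rule subset_Zorn_nonempty)
    show "\<A> \<noteq> {}" using assms by (auto simp: \<A>_def)
    fix \<C> assume C: "\<C> \<noteq> {}" "subset.chain \<A> \<C>"
    then have "subset.chain {J. graded_ideal G J} \<C>" by (auto simp: subset.chain_def \<A>_def)
    with C show "\<Union>\<C> \<in> \<A>"
      using graded_ideal_Union_chain[OF C(1)] by (auto simp: \<A>_def subset.chain_def)
  qed
  then obtain p where p: "p \<in> \<A>" and max: "\<And>J. J \<in> \<A> \<Longrightarrow> p \<subseteq> J \<Longrightarrow> J = p" by blast
  then have gp: "graded_ideal G p" and Ip: "I \<subseteq> p" and hp: "\<And>n. h ^ n \<notin> p"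
    by (auto simp: \<A>_def)
  have ip: "is_ideal p" using gp by (simp add: graded_ideal_def)
  have power: "\<exists>n k. h ^ n - k * f \<in> p" if f: "homogeneous G f" "f \<notin> p" for f
  proof -
    let ?J = "ideal_gen (insert f p)"
    have sub: "insert f p \<subseteq> ?J" by (rule idl.span_superset)
    then have "?J \<notin> \<A>" using max[of ?J] f(2) by blast
    moreover have "graded_ideal G ?J" by (rule graded_ideal_gen_insert[OF gp f(1)])
    ultimately obtain n where "h ^ n \<in> ?J" using sub Ip by (auto simp: \<A>_def)
    then show ?thesis using ip by (auto simp: idl.span_insert idl.span_eq_iff[THEN iffD2])
  qed
  have "f \<in> p \<or> g \<in> p" if fg: "homogeneous G f" "homogeneous G g" "f * g \<in> p" for f g
  proof (rule ccontr)
    assume "\<not> (f \<in> p \<or> g \<in> p)"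
    then have "f \<notin> p" "g \<notin> p" by auto
    then obtain n k m l where q: "h ^ n - k * f \<in> p" and q': "h ^ m - l * g \<in> p"
      using power[OF fg(1)] power[OF fg(2)] by blast
    \<comment> \<open>\<open>scale_scale\<close> is associativity read from right to left, which loops with \<open>mult.assoc\<close>.\<close>
    have "a * b = b * (a - k * f) + k * f * (b - l * g) + k * l * (f * g)" for a b
      by (simp add: algebra_simps del: idl.scale_scale)
    then have "h ^ (n + m) = h ^ m * (h ^ n - k * f) + k * f * (h ^ m - l * g) + k * l * (f * g)"
      unfolding power_add .
    also have "\<dots> \<in> p"
      by (intro idl.subspace_add[OF ip] idl.subspace_scale[OF ip q] idl.subspace_scale[OF ip q']
          idl.subspace_scale[OF ip fg(3)])
    finally show False using hp by blast
  qed
  moreover have "h \<notin> p" using hp[of 1] by simp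
  ultimately show ?thesis using that gp Ip unfolding D_prime_ideal_def by blast
qed

text \<open>The graded counterpart of the fact that a prime containing \<open>J \<inter> B\<close> contains \<open>J\<close> or \<open>B\<close>.
  Since only one of the two ideals is graded, the primality of \<open>p\<close> is applied to a homogeneous
  element of \<open>J\<close> and the components of an element of \<open>B\<close>; these components may lie outside \<open>B\<close>,
  but their products with \<open>j\<close> lie in \<open>p\<close> because \<open>p\<close> is graded.\<close>

lemma graded_ideal_subset_of_Int_subset:
  assumes p: "D_prime_ideal G p" and J: "graded_ideal G J" and B: "is_ideal B"
    and sub: "J \<inter> B \<subseteq> p" and nB: "\<not> B \<subseteq> p"
  shows "J \<subseteq> p"
proof
  fix x assume x: "x \<in> J"
  have gp: "graded_ideal G p" using p by (simp add: D_prime_ideal_def)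
  obtain b where b: "b \<in> B" "b \<notin> p" using nB by blast
  obtain s where s: "homogeneous_decomposition G b s" using ex_decomp .
  obtain e where e: "s e \<notin> p" using mem_graded_ideal_iff[OF gp s] b by blast
  obtain c where c: "homogeneous_decomposition G x c" using ex_decomp .
  have hom: "c d \<in> G d" "s d \<in> G d" for d
    using c s by (simp_all add: homogeneous_decomposition_def)
  have "c d \<in> p" for d
  proof -
    have "c d \<in> J" using mem_graded_ideal_iff[OF J c] x by blast
    then have "b * c d \<in> J" "c d * b \<in> B"
      using J B b(1) by (auto simp: graded_ideal_def intro: idl.subspace_scale)
    then have "c d * b \<in> p" using sub by (auto simp: mult.commute)
    then have "c d * s (d + e - d) \<in> p"
      using mem_graded_ideal_iff[OF gp decomp_mult[OF hom(1) s]] by blast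
    then have "c d * s e \<in> p" by simp
    then show "c d \<in> p"
      using D_prime_mult[OF p] hom e unfolding homogeneous_def by blast
  qed
  then show "x \<in> p" using mem_graded_ideal_iff[OF gp c] by blast
qed

end

section \<open>Vanishing ideals and closures in Proj\<close>

context conical_ring
begin

lemma vanishing_ideal_eq_Inter: "Y \<subseteq> Proj G B \<Longrightarrow> vanishing_ideal G B Y = \<Inter>Y \<inter> B"
  by (auto simp: vanishing_ideal_def V_plus_def)

lemma vanishing_ideal_V_plus_radical:
  assumes E: "E \<subseteq> B" "\<forall>x\<in>E. homogeneous G x" and radical: "rad (ideal_gen E) = ideal_gen E"
  shows "vanishing_ideal G B (V_plus G B E) = ideal_gen E"
proof
  have EB: "ideal_gen E \<subseteq> B" by (rule idl.span_minimal[OF E(1) ideal_B])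
  have "ideal_gen E \<subseteq> p" if "p \<in> V_plus G B E" for p
    using that by (intro idl.span_minimal)
      (auto simp: V_plus_def Proj_def D_prime_ideal_def graded_ideal_def)
  then show "ideal_gen E \<subseteq> vanishing_ideal G B (V_plus G B E)"
    using EB by (auto simp: vanishing_ideal_def V_plus_def)
next
  show "vanishing_ideal G B (V_plus G B E) \<subseteq> ideal_gen E"
  proof (rule subsetI, rule ccontr)
    fix f assume f: "f \<in> vanishing_ideal G B (V_plus G B E)" and nf: "f \<notin> ideal_gen E"
    have I: "graded_ideal G (ideal_gen E)" by (rule graded_ideal_gen_homogeneous[OF E(2)])
    obtain c where c: "homogeneous_decomposition G f c" using ex_decomp .
    obtain d where "c d \<notin> ideal_gen E" using mem_graded_ideal_iff[OF I c] nf by blast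
    then have "c d ^ n \<notin> ideal_gen E" for n using radical unfolding rad_def by blast
    then obtain p where p: "D_prime_ideal G p" "ideal_gen E \<subseteq> p" "c d \<notin> p"
      using separating_D_prime[OF I] by blast
    have "f \<notin> p" using mem_graded_ideal_iff[OF _ c] p by (auto simp: D_prime_ideal_def)
    then have "p \<in> V_plus G B E"
      using p f idl.span_superset[of E] by (auto simp: V_plus_def Proj_def vanishing_ideal_def)
    with f \<open>f \<notin> p\<close> show False by (auto simp: vanishing_ideal_def V_plus_def)
  qed
qed

lemma closure_of_Proj:
  assumes Y: "Y \<subseteq> Proj G B"
  shows "Proj_topology G B closure_of Y = V_plus G B (vanishing_ideal G B Y)"
proof -
  let ?J = "\<Inter>Y" let ?H = "{g \<in> \<Inter>Y. homogeneous G g}"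
  have gr: "graded_ideal G p" if "p \<in> Proj G B" for p
    using that by (simp add: Proj_def D_prime_ideal_def)
  have J: "graded_ideal G ?J" using Y gr by (blast intro: graded_ideal_Inter)
  \<comment> \<open>Closed sets are described by homogeneous elements; those of \<open>J\<close> generate it.\<close>
  have "?J \<subseteq> p" if p: "p \<in> Proj G B" "?H \<subseteq> p" for p
  proof
    fix x assume x: "x \<in> ?J"
    obtain c where c: "homogeneous_decomposition G x c" using ex_decomp .
    have "c d \<in> ?H" for d
      using c mem_graded_ideal_iff[OF J c] x
      by (auto simp: homogeneous_decomposition_def homogeneous_def)
    then show "x \<in> p" using p(2) mem_graded_ideal_iff[OF gr[OF p(1)] c] by blast
  qed
  then have H: "V_plus G B ?J = V_plus G B ?H" by (auto simp: V_plus_def)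
  have "?J \<inter> B \<subseteq> p \<longleftrightarrow> ?J \<subseteq> p" if "p \<in> Proj G B" for p
    using graded_ideal_subset_of_Int_subset[OF _ J ideal_B, of p] that by (auto simp: Proj_def)
  then have VJ: "V_plus G B (vanishing_ideal G B Y) = V_plus G B ?J"
    unfolding vanishing_ideal_eq_Inter[OF Y] V_plus_def by blast
  show ?thesis unfolding VJ
  proof (rule closure_of_unique)
    show "Y \<subseteq> V_plus G B ?J" using Y by (auto simp: V_plus_def)
    show "closedin (Proj_topology G B) (V_plus G B ?J)"
      unfolding closedin_Proj_iff H by (intro exI[of _ ?H]) simp
    fix T assume "Y \<subseteq> T" "closedin (Proj_topology G B) T"
    then obtain E where "T = V_plus G B E" "Y \<subseteq> V_plus G B E"
      by (auto simp: closedin_Proj_iff)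
    then show "V_plus G B ?J \<subseteq> T" by (auto simp: V_plus_def)
  qed
qed

end

theorem corollary2p24:
  fixes G :: "'d::ab_group_add \<Rightarrow> 'a::idom set"
    and B :: "'a set"
  assumes "\<exists>A::'d set. finite A \<and> group_closure A = UNIV"
    and "conical_ring G B"
    and "factorially_graded G"
    and "effectively_graded G"
  shows "(\<forall>E. E \<subseteq> B \<longrightarrow> (\<forall>x\<in>E. homogeneous G x) \<longrightarrow> rad (ideal_gen E) = ideal_gen E \<longrightarrow>
            vanishing_ideal G B (V_plus G B E) = rad_in B (ideal_gen E \<inter> B)) \<and>
         (\<forall>Y. Y \<subseteq> Proj G B \<longrightarrow>
            Proj_topology G B closure_of Y = V_plus G B (vanishing_ideal G B Y))"
proof (intro conjI allI impI)
  interpret conical_ring G B by fact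
  fix E assume E: "E \<subseteq> B" "\<forall>x\<in>E. homogeneous G x" and radical: "rad (ideal_gen E) = ideal_gen E"
  have "ideal_gen E \<subseteq> B" by (rule idl.span_minimal[OF E(1) ideal_B])
  then have "rad_in B (ideal_gen E \<inter> B) = ideal_gen E"
    using radical by (simp add: rad_in_def Int_absorb2)
  then show "vanishing_ideal G B (V_plus G B E) = rad_in B (ideal_gen E \<inter> B)"
    using vanishing_ideal_V_plus_radical[OF E radical] by simp
next
  interpret conical_ring G B by fact
  fix Y assume "Y \<subseteq> Proj G B"
  then show "Proj_topology G B closure_of Y = V_plus G B (vanishing_ideal G B Y)"
    by (rule closure_of_Proj)
qed

end
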